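(* Let $a$, $b$, $n$ be complex parameters with $n\notin\{0,-1,-2,\ldots\}$ and $a+n\notin\{0,-1,-2,\ldots\}$, and let $$ f(n)=\sum_{k=0}^{\infty}\frac{(a)_k\,(b)_k}{(n)_k\,(a+n)_k}. $$ If the series $f(n)$ and $f(n+1)$ converge, and $(b-2n)(1+b-2n)\neq 0$, then $$ f(n) = \frac{b-2bn+n(-2+a+3n)}{(b-2n)(1+b-2n)} + \frac{(a-n)(b-n)(a-b+n)}{(b-2n)(1+b-2n)(a+n)}\, f(n+1). $$
   Context: For a complex number $x$ and an integer $k\ge 0$, $(x)_k = x(x+1)\cdots(x+k-1)$ denotes the Pochhammer symbol (rising factorial), with $(x)_0=1$. Here $f(n+1)$ is the same series with $n$ replaced by $n+1$ and with $a,b$ unchanged, i.e. $f(n+1)=\sum_{k\ge 0}(a)_k(b)_k/\bigl((n+1)_k(a+n+1)_k\bigr)$. *)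

theory Defs
  imports Complex_Main "HOL-Library.Nonpos_Ints"
begin

definition f_term :: "complex \<Rightarrow> complex \<Rightarrow> complex \<Rightarrow> nat \<Rightarrow> complex" where
  "f_term a b n k =
     (pochhammer a k * pochhammer b k) / (pochhammer n k * pochhammer (a + n) k)"

text \<open>Only meaningful when the series converges, which \<^const>\<open>suminf\<close> does not enforce.\<close>

definition f_series :: "complex \<Rightarrow> complex \<Rightarrow> complex \<Rightarrow> complex" where
  "f_series a b n = (\<Sum>k. f_term a b n k)"

end

theory Submission
  imports Defs "HOL-Analysis.Summation_Tests"
begin

text \<open>
  The recurrence is a telescoping identity in the style of Gosper and Zeilberger. Write \<open>t k\<close> and
  \<open>s k\<close> for the summands of \<open>f(n)\<close> and \<open>f(n+1)\<close>, and \<open>C\<close> for the coefficient of \<open>f(n+1)\<close>. Then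
  \<open>t k - C s k = G (k+1) - G k\<close> for \<open>G k = (\<alpha> k + \<beta>) t k\<close>. Indeed both \<open>s k\<close> and \<open>t (k+1)\<close> are
  rational multiples of \<open>t k\<close> with the common denominator \<open>(n+k)(a+n+k)\<close>. Clearing it leaves an
  identity of polynomials in \<open>k\<close> whose cubic terms cancel, so that the three remaining coefficients
  give three linear equations for the three unknowns \<open>\<alpha>\<close>, \<open>\<beta>\<close> and \<open>C\<close>. The solution has
  \<open>\<alpha> = 1/(1+b-2n)\<close>, and \<open>-\<beta>\<close> is the rational term of the theorem.

  Summation gives \<open>f(n) - C f(n+1) = lim G - G 0 = lim G - \<beta>\<close>, and what remains is \<open>lim G = 0\<close>.
  Convergence of the two series makes \<open>G\<close> converge, and it forces \<open>t k\<close> to tend to \<open>0\<close>, so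
  \<open>k t k\<close> converges as well because \<open>\<alpha> \<noteq> 0\<close>. A nonzero limit of \<open>k t k\<close> would let \<open>f(n)\<close> diverge
  like the harmonic series (\<open>summable_imp_limit_index_mult_eq_0\<close>), hence \<open>k t k\<close> and \<open>G\<close> tend
  to \<open>0\<close>.
\<close>

text \<open>
  Without absolute convergence one cannot compare norms. Dividing by the limit makes the
  real parts eventually dominate half of the harmonic series, and real parts do inherit
  convergence.
\<close>
lemma summable_imp_limit_index_mult_eq_0:
  fixes u :: "nat \<Rightarrow> complex"
  assumes "summable u" and lim: "(\<lambda>k. of_nat k * u k) \<longlonglongrightarrow> L"
  shows "L = 0"
proof (rule ccontr)
  assume "L \<noteq> 0"
  have "(\<lambda>k. Re (of_nat k * u k / L)) \<longlonglongrightarrow> Re (L / L)"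
    by (intro tendsto_intros lim \<open>L \<noteq> 0\<close>)
  then have "\<forall>\<^sub>F k in sequentially. Re (of_nat k * u k / L) > 1 / 2"
    by (rule order_tendstoD) (simp add: \<open>L \<noteq> 0\<close>)
  moreover have "Re (of_nat k * u k / L) = real k * Re (u k / L)" for k
    by (metis Re_complex_of_real Im_complex_of_real mult_zero_left diff_zero times_complex.sel(1)
        of_real_of_nat_eq times_divide_eq_right)
  ultimately have "\<forall>\<^sub>F k in sequentially. real k * Re (u k / L) > 1 / 2"
    by simp
  then have bound: "\<forall>\<^sub>F k in sequentially. norm (inverse (real k)) \<le> 2 * Re (u k / L)"
    using eventually_gt_at_top[of 0]
    by eventually_elim (simp add: field_simps)
  have "summable (\<lambda>k. 2 * Re (u k / L))"
    by (intro summable_mult summable_Re summable_divide assms)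
  then have "summable (\<lambda>k. inverse (real k))"
    using bound by (rule summable_comparison_test_ev[rotated])
  then show False
    using not_summable_harmonic[where 'a = real] by simp
qed

lemma add_of_nat_neq_0:
  fixes z :: complex
  assumes "z \<notin> \<int>\<^sub>\<le>\<^sub>0"
  shows "z + of_nat k \<noteq> 0"
  using assms plus_of_nat_eq_0_imp by blast

lemma f_term_Suc:
  "f_term a b n (Suc k) =
     f_term a b n k * ((a + of_nat k) * (b + of_nat k)) / ((n + of_nat k) * (a + n + of_nat k))"
  by (simp add: f_term_def pochhammer_Suc mult_ac)

lemma f_term_plus_1:
  assumes "n \<notin> \<int>\<^sub>\<le>\<^sub>0" "a + n \<notin> \<int>\<^sub>\<le>\<^sub>0"
  shows "f_term a b (n + 1) k =
           f_term a b n k * (n * (a + n)) / ((n + of_nat k) * (a + n + of_nat k))"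
proof -
  have shift: "pochhammer (z + 1) k = pochhammer z k * (z + of_nat k) / z" if "z \<noteq> 0" for z :: complex
    using that pochhammer_rec[of z k] pochhammer_Suc[of z k] by (simp add: field_simps)
  have "n \<noteq> 0" "a + n \<noteq> 0"
    using assms by auto
  then show ?thesis
    using shift[of n] shift[of "a + n"] by (simp add: f_term_def add.assoc)
qed

text \<open>
  The discrete antiderivative \<open>G\<close> of the telescoping identity. At \<open>k = 0\<close> the linear factor is \<open>\<beta>\<close>, so the lower
  boundary of the telescoping sum yields the rational term of the recurrence.
\<close>
definition certificate :: "complex \<Rightarrow> complex \<Rightarrow> complex \<Rightarrow> nat \<Rightarrow> complex" where
  "certificate a b n k =
     (of_nat k / (1 + b - 2 * n)
       - (b - 2 * b * n + n * (- 2 + a + 3 * n)) / ((b - 2 * n) * (1 + b - 2 * n)))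
     * f_term a b n k"

lemma certificate_telescopes:
  assumes "n \<notin> \<int>\<^sub>\<le>\<^sub>0" "a + n \<notin> \<int>\<^sub>\<le>\<^sub>0" "(b - 2 * n) * (1 + b - 2 * n) \<noteq> 0"
  shows "f_term a b n k
           - ((a - n) * (b - n) * (a - b + n)) / ((b - 2 * n) * (1 + b - 2 * n) * (a + n))
             * f_term a b (n + 1) k
         = certificate a b n (Suc k) - certificate a b n k"
proof -
  define x where "x = (of_nat k :: complex)"
  define t where "t = f_term a b n k"
  define p where "p = b - 2 * n"
  define q where "q = 1 + b - 2 * n"
  define r where "r = b - 2 * b * n + n * (- 2 + a + 3 * n)"
  define m where "m = (a - n) * (b - n) * (a - b + n)"
  define d where "d = (n + x) * (a + n + x)"
  have "p \<noteq> 0" "q \<noteq> 0"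
    using assms(3) by (auto simp: p_def q_def)
  have "d \<noteq> 0"
    using assms(1,2) by (simp add: d_def x_def add_of_nat_neq_0)
  have "a + n \<noteq> 0"
    using assms(2) by auto
  \<comment> \<open>The polynomial identity in \<open>x = k\<close> left after all denominators are cleared.\<close>
  have "p * q * d - m * n = ((x + 1) * p - r) * ((a + x) * (b + x)) - (x * p - r) * d"
    unfolding p_def q_def r_def m_def d_def by algebra
  then have "t - m / (p * q * (a + n)) * (t * (n * (a + n)) / d)
      = ((x + 1) / q - r / (p * q)) * (t * ((a + x) * (b + x)) / d) - (x / q - r / (p * q)) * t"
    using \<open>p \<noteq> 0\<close> \<open>q \<noteq> 0\<close> \<open>d \<noteq> 0\<close> \<open>a + n \<noteq> 0\<close>
    by (simp add: divide_simps) algebra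
  then show ?thesis
    by (simp add: certificate_def f_term_Suc f_term_plus_1[OF assms(1,2)] x_def t_def
        p_def q_def r_def m_def d_def add.commute[of 1])
qed

theorem theorem4p27:
  fixes a b n :: complex
  assumes "n \<notin> \<int>\<^sub>\<le>\<^sub>0"
    and "a + n \<notin> \<int>\<^sub>\<le>\<^sub>0"
    and "summable (f_term a b n)"
    and "summable (f_term a b (n + 1))"
    and "(b - 2 * n) * (1 + b - 2 * n) \<noteq> 0"
  shows "f_series a b n =
      (b - 2 * b * n + n * (- 2 + a + 3 * n)) / ((b - 2 * n) * (1 + b - 2 * n))
    + ((a - n) * (b - n) * (a - b + n)) / ((b - 2 * n) * (1 + b - 2 * n) * (a + n))
        * f_series a b (n + 1)"
proof -
  define C where
    "C = ((a - n) * (b - n) * (a - b + n)) / ((b - 2 * n) * (1 + b - 2 * n) * (a + n))"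
  define S where "S = f_series a b n - C * f_series a b (n + 1)"
  define r where "r = (b - 2 * b * n + n * (- 2 + a + 3 * n)) / ((b - 2 * n) * (1 + b - 2 * n))"
  define q where "q = 1 + b - 2 * n"
  let ?t = "f_term a b n" and ?G = "certificate a b n"
  have "q \<noteq> 0"
    using assms(5) by (auto simp: q_def)
  have G0: "?G 0 = - r"
    by (simp add: certificate_def f_term_def r_def)
  have "(\<lambda>k. ?t k - C * f_term a b (n + 1) k) sums S"
    unfolding S_def f_series_def
    by (intro sums_diff sums_mult summable_sums assms(3,4))
  then have "(\<lambda>k. ?G (Suc k) - ?G k) sums S"
    unfolding C_def certificate_telescopes[OF assms(1,2,5)] .
  then have "(\<lambda>N. ?G N - ?G 0) \<longlonglongrightarrow> S"
    by (simp add: sums_def sum_lessThan_telescope)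
  then have "(\<lambda>N. ?G N - ?G 0 + ?G 0) \<longlonglongrightarrow> S + ?G 0"
    by (intro tendsto_intros)
  then have G_lim: "?G \<longlonglongrightarrow> S - r"
    by (simp add: G0)
  have "(\<lambda>k. q * (?G k + r * ?t k)) \<longlonglongrightarrow> q * ((S - r) + r * 0)"
    by (intro tendsto_intros G_lim summable_LIMSEQ_zero assms(3))
  moreover have "q * (?G k + r * ?t k) = of_nat k * ?t k" for k
  proof -
    have "?G k = (of_nat k / q - r) * ?t k"
      unfolding certificate_def r_def q_def ..
    then show ?thesis
      using \<open>q \<noteq> 0\<close> by (simp add: field_simps)
  qed
  ultimately have "(\<lambda>k. of_nat k * ?t k) \<longlonglongrightarrow> q * (S - r)"
    by simp
  then have "q * (S - r) = 0"
    by (rule summable_imp_limit_index_mult_eq_0[OF assms(3)])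
  then have "S = r"
    using \<open>q \<noteq> 0\<close> by simp
  then have "f_series a b n = r + C * f_series a b (n + 1)"
    by (simp add: S_def diff_eq_eq)
  then show ?thesis
    by (simp add: r_def C_def)
qed

end
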